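(* In the uniform random temporal graph where the underlying graph $G$ is the complete graph on $n$ vertices and the labels are chosen from $\{1,2,\ldots,\alpha\}$ with $\alpha\ge 4$, one can delete all but $\Theta(n\log n+\log^2 n)$ labels without violating TC, with probability at least $1-\frac{1}{n^2}$.
   Context: A uniform random temporal graph is a graph $G$ on $n$ vertices, each edge of which receives exactly one label, chosen uniformly at random from $\{1,2,\ldots,\alpha\}$, $\alpha\in\mathbb{N}^*$, independently of the labels of all other edges. A $(u,v)$-journey is a path from $u$ to $v$ whose successive edges carry strictly increasing labels. A labelled graph satisfies TC (is temporally connected) if for every ordered pair of distinct vertices $u,v$ there is a $(u,v)$-journey. Deleting the label of an edge makes the edge unusable in journeys. *)

theory Defs
  imports "HOL-Probability.Probability" "HOL-Library.Landau_Symbols"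
begin

text \<open>
  Simple undirected graphs are given by a vertex set together with a set of edges, each edge being
  a two-element set of vertices.
\<close>

definition complete_edges :: "'a set \<Rightarrow> 'a set set" where
  "complete_edges V = {e. e \<subseteq> V \<and> card e = 2}"

definition uniform_labelling :: "'a set set \<Rightarrow> nat \<Rightarrow> ('a set \<Rightarrow> nat) pmf" where
  "uniform_labelling E \<alpha> = Pi_pmf E 0 (\<lambda>_. pmf_of_set {1..\<alpha>})"

definition path_edges :: "'a list \<Rightarrow> 'a set list" where
  "path_edges p = map (\<lambda>(x, y). {x, y}) (zip p (tl p))"

text \<open>
  The argument \<open>F\<close> below is the set of edges whose label has not been deleted; the value
  of the labelling outside \<open>F\<close> is irrelevant.
\<close>

definition journey :: "'a set set \<Rightarrow> ('a set \<Rightarrow> nat) \<Rightarrow> 'a \<Rightarrow> 'a \<Rightarrow> 'a list \<Rightarrow> bool" where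
  "journey F l u v p \<longleftrightarrow>
     p \<noteq> [] \<and> hd p = u \<and> last p = v \<and> distinct p \<and>
     set (path_edges p) \<subseteq> F \<and> sorted_wrt (<) (map l (path_edges p))"

definition temporally_connected :: "'a set \<Rightarrow> 'a set set \<Rightarrow> ('a set \<Rightarrow> nat) \<Rightarrow> bool" where
  "temporally_connected V F l \<longleftrightarrow>
     (\<forall>u\<in>V. \<forall>v\<in>V. u \<noteq> v \<longrightarrow> (\<exists>p. journey F l u v p))"

end

theory Submission
  imports Defs "HOL-Real_Asymp.Real_Asymp"
begin

text \<open>
  Keep exactly the edges meeting a fixed set of \<open>k = \<lceil>11 ln n\<rceil>\<close> hubs, at most \<open>nk\<close> edges in all.
  A pair containing a hub is joined by a kept edge. For a pair \<open>u, v\<close> of other vertices,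
  each hub \<open>s\<close> yields the two-edge path \<open>u, s, v\<close>, whose labels are increasing with probability
  \<open>(1 - 1/\<alpha>)/2 \<ge> 3/8\<close>, independently for different hubs. Hence all of them fail with probability
  at most \<open>(5/8)\<^sup>k \<le> n\<^sup>-\<^sup>4\<close>, and a union bound over the at most \<open>n\<^sup>2\<close> pairs gives \<open>n\<^sup>-\<^sup>2\<close>.
\<close>

section \<open>Independent labels: pairs of coordinates and their comparison\<close>

lemma map_Pi_pmf_pair:
  assumes "finite I" "x \<in> I" "y \<in> I" "x \<noteq> y"
  shows "map_pmf (\<lambda>f. (f x, f y)) (Pi_pmf I d p) = pair_pmf (p x) (p y)"
proof -
  define J where "J = I - {x}"
  have J: "finite J" "x \<notin> J" "y \<in> J" "I = insert x J"
    using assms by (auto simp: J_def)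
  have "map_pmf (\<lambda>f. (f x, f y)) (Pi_pmf I d p)
      = map_pmf (\<lambda>(i, f). (i, f y)) (pair_pmf (p x) (Pi_pmf J d p))"
    unfolding J(4) using J assms(4)
    by (subst Pi_pmf_insert) (auto simp: map_pmf_comp case_prod_unfold)
  also have "\<dots> = pair_pmf (p x) (map_pmf (\<lambda>f. f y) (Pi_pmf J d p))"
    by (simp add: pair_map_pmf2 case_prod_unfold apsnd_def map_prod_def)
  also have "map_pmf (\<lambda>f. f y) (Pi_pmf J d p) = p y"
    using J by (subst Pi_pmf_component) auto
  finally show ?thesis .
qed

text \<open>The index blocks \<open>{a s, b s}\<close> are pairwise disjoint, so the restrictions of
  \<open>f\<close> to them are independent. Each event reads only its own block, and the probability
  of the conjunction factors. In the application, \<open>a s\<close> and \<open>b s\<close> are the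
  two edges of the path through hub \<open>s\<close>.\<close>

lemma prob_Pi_pmf_pairs:
  fixes p :: "'a \<Rightarrow> 'b :: countable pmf"
  assumes I: "finite I" "finite S" and a: "\<And>s. s \<in> S \<Longrightarrow> a s \<in> I" and b: "\<And>s. s \<in> S \<Longrightarrow> b s \<in> I"
    and inj: "inj_on a S" "inj_on b S" and disj: "a ` S \<inter> b ` S = {}"
  shows "measure_pmf.prob (Pi_pmf I d p) {f. \<forall>s\<in>S. R (f (a s)) (f (b s))} =
    (\<Prod>s\<in>S. measure_pmf.prob (pair_pmf (p (a s)) (p (b s))) {(i, j). R i j})"
\<comment> \<open>The product rule \<open>indep_varsD_finite\<close> requires a nonempty index set,
  so the empty case is split off; there both sides are 1.\<close>
proof (cases "S = {}")
  case True
  then show ?thesis by simp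
next
  case False
  let ?M = "Pi_pmf I d p"
  let ?K = "\<lambda>s. {a s, b s}"
  have "disjoint_family_on ?K S"
    unfolding disjoint_family_on_def
  proof (intro ballI impI)
    fix s t assume "s \<in> S" "t \<in> S" "s \<noteq> t"
    moreover from this have "a s \<noteq> a t" "b s \<noteq> b t"
      using inj by (auto dest: inj_onD)
    moreover have "a s \<noteq> b t" "a t \<noteq> b s"
      using disj \<open>s \<in> S\<close> \<open>t \<in> S\<close> by blast+
    ultimately show "?K s \<inter> ?K t = {}" by simp
  qed
  then have "prob_space.indep_vars ?M (\<lambda>s. PiM (?K s) (\<lambda>_. count_space UNIV))
      (\<lambda>s f. restrict (\<lambda>i. f i) (?K s)) S"
    using a b
    by (intro prob_space.indep_vars_restrict[OF measure_pmf.prob_space_axioms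
          indep_vars_Pi_pmf[OF I(1)]]) auto
  then have "prob_space.indep_vars ?M (\<lambda>_. count_space UNIV)
      (\<lambda>s f. (\<lambda>g. R (g (a s)) (g (b s))) (restrict (\<lambda>i. f i) (?K s))) S"
    by (rule prob_space.indep_vars_compose2[OF measure_pmf.prob_space_axioms]) measurable
  then have indep: "prob_space.indep_vars ?M (\<lambda>_. count_space UNIV) (\<lambda>s f. R (f (a s)) (f (b s))) S"
    by simp
  have "measure_pmf.prob ?M {f. \<forall>s\<in>S. R (f (a s)) (f (b s))} =
      measure_pmf.prob ?M (\<Inter>s\<in>S. (\<lambda>f. R (f (a s)) (f (b s))) -` {True} \<inter> space ?M)"
    using False by (intro arg_cong[where f = "measure_pmf.prob ?M"]) auto
  also have "\<dots> = (\<Prod>s\<in>S. measure_pmf.prob ?M ((\<lambda>f. R (f (a s)) (f (b s))) -` {True} \<inter> space ?M))"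
    using False I
    by (intro prob_space.indep_varsD_finite[OF measure_pmf.prob_space_axioms indep]) auto
  also have "\<dots> = (\<Prod>s\<in>S. measure_pmf.prob (map_pmf (\<lambda>f. (f (a s), f (b s))) ?M) {(i, j). R i j})"
    by (simp add: vimage_def)
  also have "\<dots> = (\<Prod>s\<in>S. measure_pmf.prob (pair_pmf (p (a s)) (p (b s))) {(i, j). R i j})"
    using I a b disj by (intro prod.cong refl, subst map_Pi_pmf_pair) auto
  finally show ?thesis .
qed

lemma pair_pmf_of_set:
  assumes "finite A" "A \<noteq> {}" "finite B" "B \<noteq> {}"
  shows "pair_pmf (pmf_of_set A) (pmf_of_set B) = pmf_of_set (A \<times> B)"
  using assms by (intro pmf_eqI) (simp add: pmf_pair indicator_def split_paired_all)

lemma card_ordered_pairs: "2 * card {(i, j). i \<in> {1..m} \<and> j \<in> {1..m} \<and> j \<le> i} = m * (m + 1)"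
proof -
  have "{(i, j). i \<in> {1..m} \<and> j \<in> {1..m} \<and> j \<le> i} = (SIGMA i:{1..m}. {1..i})"
    by auto
  then have "card {(i, j). i \<in> {1..m} \<and> j \<in> {1..m} \<and> j \<le> i} = (\<Sum>i=1..m. i)"
    by simp
  then show ?thesis
    using double_gauss_sum_from_Suc_0[of m, where ?'a = nat] by simp
qed

text \<open>The exact value is \<open>(m + 1) / (2 * m)\<close>, that is, 1/2 plus half the
  probability of a tie. It decreases in \<open>m\<close> and equals 5/8 at \<open>m = 4\<close>,
  which is where the assumption on the number of labels enters.\<close>

lemma prob_not_increasing:
  fixes m :: nat
  assumes "m \<ge> 4"
  shows "measure_pmf.prob (pair_pmf (pmf_of_set {1..m}) (pmf_of_set {1..m})) {(i, j). \<not> i < j} \<le> 5/8"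
proof -
  have "{1..m} \<times> {1..m} \<inter> {(i, j). \<not> i < j} = {(i, j). i \<in> {1..m} \<and> j \<in> {1..m} \<and> j \<le> i}"
    by auto
  then have "measure_pmf.prob (pair_pmf (pmf_of_set {1..m}) (pmf_of_set {1..m})) {(i, j). \<not> i < j}
      = real (card {(i, j). i \<in> {1..m} \<and> j \<in> {1..m} \<and> j \<le> i}) / (real m * real m)"
    using assms by (simp add: pair_pmf_of_set measure_pmf_of_set)
  also have "real (card {(i, j). i \<in> {1..m} \<and> j \<in> {1..m} \<and> j \<le> i}) = real m * (real m + 1) / 2"
    using arg_cong[OF card_ordered_pairs[of m], of real] by (simp add: algebra_simps)
  also have "real m * (real m + 1) / 2 / (real m * real m) \<le> 5/8"
    using assms by (simp add: field_simps)
  finally show ?thesis .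
qed

section \<open>The hub graph and its temporal connectivity\<close>

lemma temporally_connected_mono:
  assumes "temporally_connected V F l" "F \<subseteq> F'"
  shows "temporally_connected V F' l"
proof -
  have "journey F' l u v p" if "journey F l u v p" for u v p
    using that assms(2) by (auto simp: journey_def)
  then show ?thesis
    using assms(1) unfolding temporally_connected_def by meson
qed

text \<open>The hubs are the vertices numbered below \<open>k\<close>. If \<open>k\<close> is at
  least \<open>n\<close>, as happens for small \<open>n\<close> later on, every edge is
  kept.\<close>

definition hub_edges :: "nat \<Rightarrow> nat \<Rightarrow> nat set set" where
  "hub_edges k n = {e \<in> complete_edges {..<n}. \<exists>s\<in>e. s < k}"

lemma finite_complete_edges: "finite V \<Longrightarrow> finite (complete_edges V)"
  unfolding complete_edges_def by (rule finite_subset[of _ "Pow V"]) auto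

lemma doubleton_complete_edges: "{x, y} \<in> complete_edges V \<longleftrightarrow> x \<in> V \<and> y \<in> V \<and> x \<noteq> y"
  by (auto simp: complete_edges_def card_insert_if)

lemma card_hub_edges: "card (hub_edges k n) \<le> n * k"
proof -
  have "hub_edges k n \<subseteq> (\<lambda>(s, x). {s, x}) ` ({..<k} \<times> {..<n})"
  proof
    fix e assume "e \<in> hub_edges k n"
    then obtain s where s: "s \<in> e" "s < k" "e \<subseteq> {..<n}" "card e = 2"
      by (auto simp: hub_edges_def complete_edges_def)
    then obtain x where "e = {s, x}"
      by (metis card_2_iff insert_iff singletonD insert_commute)
    then show "e \<in> (\<lambda>(s, x). {s, x}) ` ({..<k} \<times> {..<n})"
      using s by auto
  qed
  then have "card (hub_edges k n) \<le> card ({..<k} \<times> {..<n})"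
    by (rule surj_card_le[rotated]) simp
  then show ?thesis by (simp add: mult.commute)
qed

lemma journey_hub_edges_direct:
  assumes "u < n" "v < n" "u \<noteq> v" "u < k \<or> v < k"
  shows "journey (hub_edges k n) l u v [u, v]"
  using assms
  by (auto simp: journey_def path_edges_def hub_edges_def doubleton_complete_edges)

lemma journey_hub_edges_via:
  assumes "u < n" "v < n" "u \<noteq> v" "k \<le> u" "k \<le> v" "s < k" "l {u, s} < l {s, v}"
  shows "journey (hub_edges k n) l u v [u, s, v]"
  using assms
  by (auto simp: journey_def path_edges_def hub_edges_def doubleton_complete_edges)

text \<open>As \<open>u\<close> and \<open>v\<close> are distinct and neither is a hub, the edges
  \<open>{u, s}\<close> and \<open>{s, v}\<close> for \<open>s < k\<close> are \<open>2 * k\<close>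
  different edges, so the \<open>k\<close> comparisons are independent. From
  \<open>k \<le> u < n\<close> it follows that every \<open>s < k\<close> is a vertex.\<close>

lemma prob_no_hub_journey:
  assumes "u < n" "v < n" "u \<noteq> v" "k \<le> u" "k \<le> v" "\<alpha> \<ge> 4"
  shows "measure_pmf.prob (uniform_labelling (complete_edges {..<n}) \<alpha>)
      {l. \<forall>s\<in>{..<k}. \<not> l {u, s} < l {s, v}} \<le> (5/8) ^ k"
proof -
  have "measure_pmf.prob (uniform_labelling (complete_edges {..<n}) \<alpha>)
      {l. \<forall>s\<in>{..<k}. \<not> l {u, s} < l {s, v}} =
     (\<Prod>s\<in>{..<k}. measure_pmf.prob (pair_pmf (pmf_of_set {1..\<alpha>}) (pmf_of_set {1..\<alpha>}))
        {(i, j). \<not> i < j})"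
    unfolding uniform_labelling_def using assms
    by (intro prob_Pi_pmf_pairs)
       (auto simp: finite_complete_edges doubleton_complete_edges inj_on_def doubleton_eq_iff)
  also have "\<dots> \<le> (\<Prod>s\<in>{..<k}. 5/8)"
    by (intro prod_mono conjI measure_nonneg prob_not_increasing assms)
  finally show ?thesis by simp
qed

lemma prob_hub_edges_temporally_connected:
  assumes "\<alpha> \<ge> 4"
  shows "measure_pmf.prob (uniform_labelling (complete_edges {..<n}) \<alpha>)
      {l. temporally_connected {..<n} (hub_edges k n) l} \<ge> 1 - (real n)\<^sup>2 * (5/8) ^ k"
proof -
  let ?M = "uniform_labelling (complete_edges {..<n}) \<alpha>"
  let ?good = "{l. temporally_connected {..<n} (hub_edges k n) l}"
  \<comment> \<open>Ordered pairs are used because a journey from \<open>u\<close> to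
    \<open>v\<close> does not yield one back. Pairs containing a hub never fail and do not enter the
    union bound.\<close>
  let ?P = "{(u, v). u < n \<and> v < n \<and> u \<noteq> v \<and> k \<le> u \<and> k \<le> v}"
  let ?bad = "\<lambda>(u, v). {l. \<forall>s\<in>{..<k}. \<not> l {u, s} < l {s, v}}"
  have P: "?P \<subseteq> {..<n} \<times> {..<n}" by auto
  then have fin: "finite ?P" by (rule finite_subset) simp
  have card: "card ?P \<le> n\<^sup>2"
    using card_mono[OF _ P] by (simp add: power2_eq_square)
  have "- ?good \<subseteq> (\<Union>p\<in>?P. ?bad p)"
  proof
    fix l assume "l \<in> - ?good"
    then obtain u v where uv: "u < n" "v < n" "u \<noteq> v" "\<And>p. \<not> journey (hub_edges k n) l u v p"
      by (auto simp: temporally_connected_def)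
    then have k: "k \<le> u" "k \<le> v"
      by (meson journey_hub_edges_direct not_le)+
    then have "l \<in> ?bad (u, v)"
      using uv journey_hub_edges_via by fastforce
    then show "l \<in> (\<Union>p\<in>?P. ?bad p)" using uv k by blast
  qed
  then have "measure_pmf.prob ?M (- ?good) \<le> measure_pmf.prob ?M (\<Union>p\<in>?P. ?bad p)"
    by (intro measure_pmf.finite_measure_mono) auto
  also have "\<dots> \<le> (\<Sum>p\<in>?P. measure_pmf.prob ?M (?bad p))"
    using fin by (intro measure_pmf.finite_measure_subadditive_finite) auto
  also have "\<dots> \<le> (\<Sum>p\<in>?P. (5/8) ^ k)"
    using assms prob_no_hub_journey by (intro sum_mono) auto
  also have "\<dots> \<le> (real n)\<^sup>2 * (5/8) ^ k"
    using card by (simp flip: of_nat_power)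
  finally show ?thesis
    using measure_pmf.prob_compl[of ?good ?M] by (simp add: Compl_eq_Diff_UNIV)
qed

section \<open>The number of hubs and of retained labels\<close>

definition hub_count :: "nat \<Rightarrow> nat" where
  "hub_count n = nat \<lceil>11 * ln (real n)\<rceil>"

text \<open>From \<open>5/8 \<le> exp (- (3/8))\<close>, the exponent is at most
  \<open>- (33/8) * ln n\<close>, and 33/8 exceeds 4. This explains the factor 11 in
  \<open>hub_count\<close>: it is the least integer whose product with 3/8 is at least 4.\<close>

lemma power_hub_count_le:
  assumes "n \<ge> 1"
  shows "(5/8) ^ hub_count n \<le> 1 / real n ^ 4"
proof -
  have k: "real (hub_count n) \<ge> 11 * ln (real n)"
    unfolding hub_count_def by linarith
  have "(5/8 :: real) \<le> exp (- (3/8))"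
    using exp_ge_add_one_self[of "- (3/8) :: real"] by simp
  then have "(5/8 :: real) ^ hub_count n \<le> exp (- (3/8)) ^ hub_count n"
    by (intro power_mono) auto
  also have "\<dots> = exp (real (hub_count n) * - (3/8))"
    by (rule exp_of_nat_mult[symmetric])
  also have "\<dots> \<le> exp (- (of_nat 4 * ln (real n)))"
    using k assms by simp
  also have "\<dots> = 1 / real n ^ 4"
    using assms by (subst exp_minus, subst exp_of_nat_mult) (simp add: inverse_eq_divide)
  finally show ?thesis .
qed

text \<open>The number of retained edges has to be one function of \<open>n\<close> alone, attained
  exactly. The minimum caps it at the size of the complete graph, which
  \<open>n * hub_count n\<close> exceeds for small \<open>n\<close>.\<close>

definition edge_budget :: "nat \<Rightarrow> nat" where
  "edge_budget n = min (n choose 2) (n * hub_count n)"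

lemma card_complete_edges: "card (complete_edges {..<n}) = n choose 2"
  unfolding complete_edges_def using n_subsets[of "{..<n}" 2] by simp

lemma edge_budget_bigtheta:
  "(\<lambda>n. real (edge_budget n)) \<in> \<Theta>(\<lambda>n. real n * ln (real n) + (ln (real n))\<^sup>2)"
proof -
  let ?g = "\<lambda>n. real n * ln (real n)"
  have "(\<lambda>n. real (edge_budget n)) \<in> O(?g)"
  proof (rule landau_o.big_mono[THEN landau_o.big_trans])
    show "\<forall>\<^sub>F n in sequentially. norm (real (edge_budget n)) \<le> norm (real n * (11 * ln (real n) + 1))"
      using eventually_ge_at_top[of 1]
    proof eventually_elim
      case (elim n)
      then have "0 \<le> ln (real n)" by simp
      then have "real (hub_count n) \<le> 11 * ln (real n) + 1" unfolding hub_count_def by linarith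
      then have "real n * real (hub_count n) \<le> real n * (11 * ln (real n) + 1)"
        by (intro mult_left_mono) auto
      moreover have "real (edge_budget n) \<le> real n * real (hub_count n)"
        unfolding edge_budget_def by (metis min.cobounded2 of_nat_le_iff of_nat_mult)
      ultimately show ?case by simp
    qed
    show "(\<lambda>n::nat. real n * (11 * ln (real n) + 1)) \<in> O(?g)" by real_asymp
  qed
  moreover have "(\<lambda>n. real (edge_budget n)) \<in> \<Omega>(?g)"
  \<comment> \<open>Both arguments of the minimum must dominate \<open>1/4 * (n * ln n)\<close>: the
    binomial coefficient is quadratic in \<open>n\<close>, and \<open>hub_count n\<close> is at
    least \<open>11 * ln n\<close>. The value 1/4 is not optimised.\<close>
  proof (rule landau_omega.bigI[of "1/4"])
    have "\<forall>\<^sub>F n::nat in sequentially. real n * (real n - 1) / 2 \<ge> 1/4 * (real n * ln (real n))"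
      by real_asymp
    then show "\<forall>\<^sub>F n in sequentially. norm (real (edge_budget n)) \<ge> 1/4 * norm (?g n)"
      using eventually_ge_at_top[of 1]
    proof eventually_elim
      case (elim n)
      then have ln: "0 \<le> ln (real n)" by simp
      have "real (n choose 2) = real n * (real n - 1) / 2"
        using elim(2) by (simp add: choose_two real_of_nat_div)
      moreover have "real n * (1/4 * ln (real n)) \<le> real n * real (hub_count n)"
        using ln unfolding hub_count_def by (intro mult_left_mono) linarith+
      ultimately have "1/4 * ?g n \<le> real (edge_budget n)"
        using elim(1) by (simp add: edge_budget_def min_def)
      then show ?case using ln by simp
    qed
  qed simp
  ultimately have "(\<lambda>n. real (edge_budget n)) \<in> \<Theta>(?g)"
    by (rule bigthetaI)
  \<comment> \<open>The squared logarithm is of lower order than \<open>n * ln n\<close> and is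
    absorbed.\<close>
  also have "?g \<in> \<Theta>(\<lambda>n. real n * ln (real n) + (ln (real n))\<^sup>2)"
    by real_asymp
  finally show ?thesis .
qed

theorem theorem7:
  shows "\<exists>f :: nat \<Rightarrow> nat.
    (\<lambda>n. real (f n)) \<in> \<Theta>(\<lambda>n. real n * ln (real n) + (ln (real n))\<^sup>2) \<and>
    (\<forall>n \<alpha> :: nat. n \<ge> 1 \<longrightarrow> \<alpha> \<ge> 4 \<longrightarrow>
       measure_pmf.prob (uniform_labelling (complete_edges {..<n}) \<alpha>)
         {l. \<exists>F \<subseteq> complete_edges {..<n}. card F = f n \<and> temporally_connected {..<n} F l}
       \<ge> 1 - 1 / (real n)\<^sup>2)"
proof (intro exI[of _ edge_budget] conjI edge_budget_bigtheta allI impI)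
  fix n \<alpha> :: nat assume n: "n \<ge> 1" and \<alpha>: "\<alpha> \<ge> 4"
  let ?E = "complete_edges {..<n}" and ?H = "hub_edges (hub_count n) n"
  have sub: "?H \<subseteq> ?E" by (auto simp: hub_edges_def)
  then have "card ?H \<le> edge_budget n"
    using card_hub_edges[of "hub_count n" n] card_mono[OF finite_complete_edges sub]
    by (simp add: edge_budget_def card_complete_edges)
  moreover have "edge_budget n \<le> card ?E"
    by (simp add: edge_budget_def card_complete_edges)
  \<comment> \<open>The hub edges are padded with arbitrary further edges to reach the prescribed
    cardinality exactly; extra edges preserve temporal connectivity. This \<open>F\<close> is fixed
    before the labels are drawn, so one set serves all good labellings.\<close>
  ultimately obtain F where F: "?H \<subseteq> F" "F \<subseteq> ?E" "card F = edge_budget n"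
    using exists_subset_between[OF _ _ sub finite_complete_edges[OF finite_lessThan]] by blast
  have "(real n)\<^sup>2 * (5/8) ^ hub_count n \<le> (real n)\<^sup>2 * (1 / real n ^ 4)"
    by (intro mult_left_mono power_hub_count_le n) simp
  also have "\<dots> = 1 / (real n)\<^sup>2"
    using n by (simp add: field_simps flip: power_add)
  finally have "1 - 1 / (real n)\<^sup>2 \<le> 1 - (real n)\<^sup>2 * (5/8) ^ hub_count n" by simp
  also have "\<dots> \<le> measure_pmf.prob (uniform_labelling ?E \<alpha>) {l. temporally_connected {..<n} ?H l}"
    by (rule prob_hub_edges_temporally_connected[OF \<alpha>])
  also have "\<dots> \<le> measure_pmf.prob (uniform_labelling ?E \<alpha>)
      {l. \<exists>F\<subseteq>?E. card F = edge_budget n \<and> temporally_connected {..<n} F l}"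
    using F by (intro measure_pmf.finite_measure_mono) (auto dest: temporally_connected_mono)
  finally show "1 - 1 / (real n)\<^sup>2 \<le> measure_pmf.prob (uniform_labelling ?E \<alpha>)
      {l. \<exists>F\<subseteq>?E. card F = edge_budget n \<and> temporally_connected {..<n} F l}" .
qed

end
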